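(* Let $k\ge 2$ and $n_1,\dots,n_k\ge 2$ be integers. Then for the Laplacian quantum walk on $X=P_{n_1}\square\cdots\square P_{n_k}$, the corners of $X$ do not all lie in a single Laplacian PGST-equivalence class; that is, it is not the case that Laplacian pretty good state transfer occurs between every two corners of $X$.
   Context: For a simple finite graph $X$ with Laplacian matrix $L_X$, the Laplacian (Heisenberg) quantum walk is $U(t)=\exp(-itL_X)$. Laplacian pretty good state transfer from $a$ to $b$ means: for every $\epsilon>0$ there is $\tau\in\mathbb{R}$ with $|U(\tau)_{b,a}|>1-\epsilon$; this is an equivalence relation on vertices. $P_n$ denotes the path on $n$ vertices labelled $1,\dots,n$ in order; $\square$ is the cartesian product. A corner of $P_{n_1}\square\cdots\square P_{n_k}$ is a vertex $(a_1,\dots,a_k)$ with each $a_i\in\{1,n_i\}$. *)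

theory Defs
  imports "HOL-Analysis.Analysis" "Graph_Theory.Graph_Theory"
begin

text \<open>
  A finite simple graph is a \<^locale>\<open>pair_graph\<close>: a finite, loop-free, symmetric set of arcs, so
  that an edge is a pair of opposite arcs and the degree of a vertex is its
  \<^const>\<open>out_degree\<close>.  Square matrices with rows and columns indexed by a finite set
  \<open>V\<close> are functions of two arguments; only the entries on \<open>V\<close> matter.
\<close>

subsection \<open>Matrix exponential\<close>

primrec mat_power :: "'a set \<Rightarrow> ('a \<Rightarrow> 'a \<Rightarrow> complex) \<Rightarrow> nat \<Rightarrow> 'a \<Rightarrow> 'a \<Rightarrow> complex" where
  "mat_power V M 0 = (\<lambda>u v. if u = v then 1 else 0)"
| "mat_power V M (Suc j) = (\<lambda>u v. \<Sum>w\<in>V. M u w * mat_power V M j w v)"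

definition mat_exp :: "'a set \<Rightarrow> ('a \<Rightarrow> 'a \<Rightarrow> complex) \<Rightarrow> 'a \<Rightarrow> 'a \<Rightarrow> complex" where
  "mat_exp V M u v = (\<Sum>j. mat_power V M j u v / fact j)"

lemma mat_power_bound:
  assumes "finite V" and B: "\<And>u v. u \<in> V \<Longrightarrow> v \<in> V \<Longrightarrow> cmod (M u v) \<le> B"
    and "u \<in> V" and "v \<in> V"
  shows "cmod (mat_power V M j u v) \<le> (real (card V) * B) ^ j"
  using \<open>u \<in> V\<close>
proof (induction j arbitrary: u)
  case 0
  then show ?case by simp
next
  case (Suc j)
  have "0 \<le> B" using B[OF \<open>u \<in> V\<close> \<open>u \<in> V\<close>] norm_ge_zero order_trans by blast
  have "cmod (mat_power V M (Suc j) u v) \<le> (\<Sum>w\<in>V. cmod (M u w * mat_power V M j w v))"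
    by (simp add: norm_sum)
  also have "\<dots> \<le> (\<Sum>w\<in>V. B * (real (card V) * B) ^ j)"
    by (rule sum_mono) (use Suc B \<open>0 \<le> B\<close> in \<open>auto simp: norm_mult intro!: mult_mono\<close>)
  also have "\<dots> = (real (card V) * B) ^ Suc j" by simp
  finally show ?case .
qed

text \<open>The series defining \<^const>\<open>mat_exp\<close> converges on a finite index set.\<close>

lemma summable_mat_exp:
  assumes "finite V" "u \<in> V" "v \<in> V"
  shows "summable (\<lambda>j. mat_power V M j u v / fact j)"
proof -
  define B where "B = Max ((\<lambda>(u, v). cmod (M u v)) ` (V \<times> V))"
  have B: "cmod (M x y) \<le> B" if "x \<in> V" "y \<in> V" for x y
    unfolding B_def using assms(1) that by (intro Max_ge) auto
  have "cmod (mat_power V M j u v / fact j) \<le> inverse (fact j) * (real (card V) * B) ^ j" for j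
    using mat_power_bound[where M = M and B = B and j = j, OF assms(1) B assms(2,3)]
    by (simp add: norm_divide field_simps)
  then show ?thesis
    by (intro summable_comparison_test[OF _ summable_exp[of "real (card V) * B"]]) auto
qed

subsection \<open>Laplacian quantum walk and pretty good state transfer\<close>

definition laplacian :: "'a pair_pre_digraph \<Rightarrow> 'a \<Rightarrow> 'a \<Rightarrow> complex" where
  "laplacian G u v =
     (if u = v then of_nat (out_degree (with_proj G) u) else 0)
     - (if (u, v) \<in> parcs G then 1 else 0)"

definition laplacian_walk :: "'a pair_pre_digraph \<Rightarrow> real \<Rightarrow> 'a \<Rightarrow> 'a \<Rightarrow> complex" where
  "laplacian_walk G t = mat_exp (pverts G) (\<lambda>u v. - \<i> * of_real t * laplacian G u v)"

definition laplacian_pgst :: "'a pair_pre_digraph \<Rightarrow> 'a \<Rightarrow> 'a \<Rightarrow> bool" where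
  "laplacian_pgst G a b \<longleftrightarrow> (\<forall>\<epsilon>>0. \<exists>\<tau>::real. cmod (laplacian_walk G \<tau> b a) > 1 - \<epsilon>)"

subsection \<open>Paths, cartesian products and corners\<close>

definition path_graph :: "nat \<Rightarrow> nat pair_pre_digraph" where
  "path_graph n = \<lparr> pverts = {1..n},
     parcs = {(a, b). a \<in> {1..n} \<and> b \<in> {1..n} \<and> (b = a + 1 \<or> a = b + 1)} \<rparr>"

text \<open>
  The cartesian product of a family \<open>G i\<close>, \<open>i \<in> I\<close>.  A vertex is a tuple, i.e. a function on \<open>I\<close>
  (with value \<^const>\<open>undefined\<close> outside \<open>I\<close>); adjacent tuples differ in exactly one coordinate,
  where they are adjacent in the corresponding factor.
\<close>

definition cart_prod :: "'i set \<Rightarrow> ('i \<Rightarrow> 'a pair_pre_digraph) \<Rightarrow> ('i \<Rightarrow> 'a) pair_pre_digraph" where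
  "cart_prod I G = \<lparr> pverts = (\<Pi>\<^sub>E i\<in>I. pverts (G i)),
     parcs = {(x, y). x \<in> (\<Pi>\<^sub>E i\<in>I. pverts (G i)) \<and> y \<in> (\<Pi>\<^sub>E i\<in>I. pverts (G i)) \<and>
       (\<exists>i\<in>I. (x i, y i) \<in> parcs (G i) \<and> (\<forall>j\<in>I - {i}. x j = y j))} \<rparr>"

definition grid_graph :: "nat \<Rightarrow> (nat \<Rightarrow> nat) \<Rightarrow> (nat \<Rightarrow> nat) pair_pre_digraph" where
  "grid_graph k n = cart_prod {1..k} (\<lambda>i. path_graph (n i))"

definition grid_corners :: "nat \<Rightarrow> (nat \<Rightarrow> nat) \<Rightarrow> (nat \<Rightarrow> nat) set" where
  "grid_corners k n = {a \<in> pverts (grid_graph k n). \<forall>i\<in>{1..k}. a i \<in> {1, n i}}"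

lemma pair_graphI:
  assumes "finite (pverts G)" "parcs G \<subseteq> pverts G \<times> pverts G" "irrefl (parcs G)" "sym (parcs G)"
  shows "pair_graph G"
proof -
  have "finite (parcs G)" using assms(1,2) finite_subset by blast
  then show ?thesis
    using assms by unfold_locales (auto simp: symmetric_def irrefl_def)
qed

lemma pair_graph_path_graph: "pair_graph (path_graph n)"
  by (rule pair_graphI) (auto simp: path_graph_def irrefl_def sym_def)

lemma pair_graph_cart_prod:
  assumes "finite I" and G: "\<And>i. i \<in> I \<Longrightarrow> pair_graph (G i)"
  shows "pair_graph (cart_prod I G)"
proof (rule pair_graphI)
  have fin: "finite (pverts (G i))" and loop: "(u, u) \<notin> parcs (G i)"
    and sym: "(u, v) \<in> parcs (G i) \<Longrightarrow> (v, u) \<in> parcs (G i)" if "i \<in> I" for i u v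
  proof -
    interpret pair_graph "G i" by (rule G[OF that])
    show "finite (pverts (G i))" by (rule pair_finite_verts)
    show "(u, u) \<notin> parcs (G i)" using pair_no_loops by fastforce
    show "(u, v) \<in> parcs (G i) \<Longrightarrow> (v, u) \<in> parcs (G i)"
      using pair_sym_arcs by (auto simp: symmetric_def dest: symD)
  qed
  show "finite (pverts (cart_prod I G))"
    using assms(1) fin by (auto simp: cart_prod_def intro!: finite_PiE)
  show "parcs (cart_prod I G) \<subseteq> pverts (cart_prod I G) \<times> pverts (cart_prod I G)"
    by (auto simp: cart_prod_def)
  show "irrefl (parcs (cart_prod I G))"
    using loop by (auto simp: cart_prod_def irrefl_def)
  show "sym (parcs (cart_prod I G))"
    unfolding cart_prod_def sym_def using sym by simp metis
qed

lemma pair_graph_grid_graph: "pair_graph (grid_graph k n)"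
  unfolding grid_graph_def by (intro pair_graph_cart_prod pair_graph_path_graph) simp

end

theory Submission
  imports Defs
begin

text \<open>
  Pretty good transfer from \<open>a\<close> to \<open>b\<close> yields times \<open>\<tau>\<close> with \<open>exp (- \<i> \<tau> \<theta>) v a \<rightarrow> v b\<close> for every
  Laplacian eigenvector \<open>v\<close> with eigenvalue \<open>\<theta>\<close>.  An eigenvector of the \<open>i\<close>-th path, read off the
  \<open>i\<close>-th coordinate, is an eigenvector of the grid.  Between corners that differ only in coordinate
  \<open>i\<close>, the phases of the path eigenvalues \<open>\<theta>\<^sub>j = 2 - 2 cos (\<pi> j / n)\<close> therefore tend to \<open>(- 1) ^ j\<close> for
  the \<open>i\<close>-th path and to \<open>1\<close> for all others.  Rational relations between cosines make the former
  impossible unless \<open>n\<close> is a power of two; and of two powers of two the smaller divides the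
  larger, so \<open>\<theta>\<^sub>1\<close> of the shorter path is also an eigenvalue of the longer one and its phase would
  have to tend to both \<open>- 1\<close> and \<open>1\<close>.
\<close>

section \<open>Matrix exponentials: eigenvectors and unitarity\<close>

text \<open>Each factor \<open>M\<close> met by the left eigenvector turns into a factor
  \<open>z\<close>, so pairing \<open>v\<close> with column \<open>a\<close> reduces the matrix
  series, term by term, to the scalar exponential series.\<close>

lemma mat_exp_left_eigenvector:
  assumes "finite V" "a \<in> V"
    and eig: "\<And>w. w \<in> V \<Longrightarrow> (\<Sum>u\<in>V. v u * M u w) = z * v w"
  shows "(\<Sum>u\<in>V. v u * mat_exp V M u a) = exp z * v a"
proof -
  have pow: "(\<Sum>u\<in>V. v u * mat_power V M j u a) = z ^ j * v a" for j
  proof (induction j)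
    case 0
    then show ?case using assms by (simp add: if_distrib cong: if_cong)
  next
    case (Suc j)
    have "(\<Sum>u\<in>V. v u * mat_power V M (Suc j) u a)
        = (\<Sum>u\<in>V. \<Sum>w\<in>V. v u * M u w * mat_power V M j w a)"
      by (simp add: sum_distrib_left mult.assoc)
    also have "\<dots> = (\<Sum>w\<in>V. (\<Sum>u\<in>V. v u * M u w) * mat_power V M j w a)"
      by (subst sum.swap) (simp add: sum_distrib_right)
    also have "\<dots> = z * (\<Sum>w\<in>V. v w * mat_power V M j w a)"
      using eig by (simp add: sum_distrib_left mult.assoc)
    finally show ?case using Suc by simp
  qed
  have "(\<lambda>j. \<Sum>u\<in>V. v u * (mat_power V M j u a / fact j)) sums (\<Sum>u\<in>V. v u * mat_exp V M u a)"
    unfolding mat_exp_def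
    by (intro sums_sum sums_mult summable_sums summable_mat_exp assms)
  moreover have "(\<Sum>u\<in>V. v u * (mat_power V M j u a / fact j)) = z ^ j /\<^sub>R fact j * v a" for j
  proof -
    have "(\<Sum>u\<in>V. v u * (mat_power V M j u a / fact j)) = z ^ j * v a / fact j"
      using pow[of j] by (simp flip: sum_divide_distrib)
    then show ?thesis by (simp add: scaleR_conv_of_real field_simps)
  qed
  moreover have "(\<lambda>j. z ^ j /\<^sub>R fact j * v a) sums (exp z * v a)"
    by (intro sums_mult2 exp_converges)
  ultimately show ?thesis by (simp add: sums_unique2)
qed

text \<open>The squared norm expands as a Cauchy product. Anti-Hermitian symmetry moves all factors
  \<open>M\<close> to one side at the cost of a sign, and the binomial theorem leaves
  \<open>(- 1 + 1) ^ j\<close>, which kills every order except \<open>0\<close>.\<close>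

lemma mat_exp_antihermitian_column:
  assumes "finite V" "a \<in> V"
    and anti: "\<And>u w. u \<in> V \<Longrightarrow> w \<in> V \<Longrightarrow> cnj (M u w) = - M w u"
  shows "(\<Sum>u\<in>V. (cmod (mat_exp V M u a))\<^sup>2) = 1"
proof -
  let ?P = "mat_power V M"
  define A where "A u j = ?P j u a / fact j" for u j
  \<comment> \<open>One factor \<open>M\<close> at a time passes from the conjugated power to the
    other one, hence \<open>l\<close> varies in the induction.\<close>
  have adj: "(\<Sum>u\<in>V. cnj (?P i u a) * ?P l u a) = (- 1) ^ i * ?P (i + l) a a" for i l
  proof (induction i arbitrary: l)
    case 0
    then show ?case using assms by (simp add: if_distrib[of cnj] if_distrib[of "\<lambda>x. x * _"] cong: if_cong)
  next
    case (Suc i)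
    have "(\<Sum>u\<in>V. cnj (?P (Suc i) u a) * ?P l u a)
        = (\<Sum>u\<in>V. \<Sum>w\<in>V. cnj (M u w) * cnj (?P i w a) * ?P l u a)"
      by (simp add: sum_distrib_right)
    also have "\<dots> = (\<Sum>u\<in>V. \<Sum>w\<in>V. - (cnj (?P i w a) * (M w u * ?P l u a)))"
      by (intro sum.cong refl) (simp add: anti)
    also have "\<dots> = - (\<Sum>w\<in>V. cnj (?P i w a) * ?P (Suc l) w a)"
      by (subst sum.swap) (simp add: sum_negf sum_distrib_left)
    finally show ?case using Suc[of "Suc l"] by simp
  qed
  define B where "B = Max ((\<lambda>(u, v). cmod (M u v)) ` (V \<times> V))"
  have B: "cmod (M x y) \<le> B" if "x \<in> V" "y \<in> V" for x y
    unfolding B_def using assms(1) that by (intro Max_ge) auto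
  have summ: "summable (\<lambda>j. cmod (A u j))" if "u \<in> V" for u
  proof -
    have "norm (cmod (A u j)) \<le> inverse (fact j) * (real (card V) * B) ^ j" for j
      using mat_power_bound[where M = M and B = B and j = j, OF assms(1) B that \<open>a \<in> V\<close>]
      by (simp add: A_def norm_divide field_simps)
    then show ?thesis
      by (intro summable_comparison_test[OF _ summable_exp[of "real (card V) * B"]]) auto
  qed
  have suminf: "suminf (A u) = mat_exp V M u a" for u
    by (simp add: mat_exp_def A_def[abs_def])
  have cnj_suminf: "suminf (\<lambda>j. cnj (A u j)) = cnj (mat_exp V M u a)" if "u \<in> V" for u
    using sums_cnj[THEN iffD2, OF summable_sums[OF summable_norm_cancel[OF summ[OF that]]]]
    by (simp add: sums_iff suminf)
  have "(\<lambda>j. \<Sum>i\<le>j. cnj (A u i) * A u (j - i)) sums (cnj (mat_exp V M u a) * mat_exp V M u a)"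
    if "u \<in> V" for u
    using Cauchy_product_sums[of "\<lambda>j. cnj (A u j)" "A u"] summ[OF that] cnj_suminf[OF that] suminf
    by simp
  then have "(\<lambda>j. \<Sum>u\<in>V. \<Sum>i\<le>j. cnj (A u i) * A u (j - i))
      sums (\<Sum>u\<in>V. cnj (mat_exp V M u a) * mat_exp V M u a)"
    by (intro sums_sum)
  moreover have "(\<Sum>u\<in>V. \<Sum>i\<le>j. cnj (A u i) * A u (j - i)) = (if j = 0 then 1 else 0)" for j
  proof -
    have "(\<Sum>u\<in>V. \<Sum>i\<le>j. cnj (A u i) * A u (j - i))
        = (\<Sum>i\<le>j. (\<Sum>u\<in>V. cnj (?P i u a) * ?P (j - i) u a) / (fact i * fact (j - i)))"
      by (subst sum.swap) (simp add: A_def sum_divide_distrib)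
    also have "\<dots> = (\<Sum>i\<le>j. of_nat (j choose i) * (- 1) ^ i * 1 ^ (j - i) * (?P j a a / fact j))"
      by (intro sum.cong refl) (simp add: adj binomial_fact field_simps)
    also have "\<dots> = (- 1 + 1) ^ j * (?P j a a / fact j)"
      by (subst binomial_ring) (simp add: sum_distrib_right sum_divide_distrib)
    finally show ?thesis by simp
  qed
  moreover have "(\<lambda>j. if j = 0 then 1 else 0) sums (1::complex)"
    using sums_single[of 0 "\<lambda>_. 1::complex"] by simp
  ultimately have "(\<Sum>u\<in>V. cnj (mat_exp V M u a) * mat_exp V M u a) = 1"
    by (simp add: sums_unique2)
  then have "complex_of_real (\<Sum>u\<in>V. (cmod (mat_exp V M u a))\<^sup>2) = 1"
    by (simp add: complex_norm_square mult.commute del: of_real_power)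
  then show ?thesis by (simp only: of_real_eq_1_iff)
qed

section \<open>Laplacian eigenvectors and pretty good state transfer\<close>

text \<open>For a simple graph the sum is the Laplacian applied to \<open>v\<close> at
  \<open>w\<close>; writing it with differences along edges keeps it real and free of
  degrees.\<close>

definition laplacian_eigenvector :: "'a pair_pre_digraph \<Rightarrow> real \<Rightarrow> ('a \<Rightarrow> real) \<Rightarrow> bool" where
  "laplacian_eigenvector G \<theta> v \<longleftrightarrow>
     (\<forall>w\<in>pverts G. (\<Sum>u | (w, u) \<in> parcs G. v w - v u) = \<theta> * v w)"

text \<open>The Laplacian is symmetric, so \<open>v\<close> is also a left eigenvector and its
  pairing with a column of the walk picks up a single phase.\<close>

lemma laplacian_walk_eigenvector:
  assumes G: "pair_graph G" and "a \<in> pverts G" and eig: "laplacian_eigenvector G \<theta> v"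
  shows "(\<Sum>u\<in>pverts G. v u * laplacian_walk G t u a) = exp (- \<i> * t * \<theta>) * v a"
proof -
  interpret pair_graph G by (rule G)
  have symE: "(x, y) \<in> parcs G \<longleftrightarrow> (y, x) \<in> parcs G" for x y
    using pair_sym_arcs by (auto simp: symmetric_def dest: symD)
  have "(\<Sum>u\<in>pverts G. v u * laplacian G u w) = \<theta> * v w" if "w \<in> pverts G" for w
  proof -
    let ?N = "{u. (w, u) \<in> parcs G}"
    have N: "?N \<subseteq> pverts G" using in_arcsD2 by auto
    have "out_arcs (with_proj G) w = Pair w ` ?N"
      by (auto simp: out_arcs_def)
    then have deg: "out_degree (with_proj G) w = card ?N"
      by (simp add: out_degree_def card_image inj_on_def)
    have "(\<Sum>u\<in>pverts G. v u * laplacian G u w)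
        = (\<Sum>u\<in>pverts G. if u = w then of_real (v w) * of_nat (card ?N) else 0)
          - (\<Sum>u\<in>pverts G. if u \<in> ?N then of_real (v u) else 0)"
      unfolding sum_subtractf[symmetric]
      by (intro sum.cong refl) (auto simp: laplacian_def deg algebra_simps symE)
    also have "\<dots> = of_real (v w) * of_nat (card ?N) - (\<Sum>u\<in>?N. of_real (v u))"
      using that N by (subst sum.delta) (simp_all add: sum.If_cases Int_absorb1)
    also have "\<dots> = of_real (\<Sum>u\<in>?N. v w - v u)"
      by (simp add: sum_subtractf mult.commute)
    also have "\<dots> = of_real (\<theta> * v w)"
      using eig that by (simp only: laplacian_eigenvector_def)
    finally show ?thesis by simp
  qed
  note eigL = this
  have "(\<Sum>u\<in>pverts G. v u * (- \<i> * t * laplacian G u w)) = - \<i> * t * \<theta> * v w"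
    if "w \<in> pverts G" for w
  proof -
    have "(\<Sum>u\<in>pverts G. v u * (- \<i> * t * laplacian G u w))
        = - \<i> * t * (\<Sum>u\<in>pverts G. v u * laplacian G u w)"
      unfolding sum_distrib_left by (intro sum.cong refl) (simp add: mult_ac)
    then show ?thesis by (simp add: eigL[OF that])
  qed
  then show ?thesis
    unfolding laplacian_walk_def
    by (intro mat_exp_left_eigenvector pair_finite_verts \<open>a \<in> pverts G\<close>)
qed

lemma laplacian_walk_column:
  assumes G: "pair_graph G" and "a \<in> pverts G"
  shows "(\<Sum>u\<in>pverts G. (cmod (laplacian_walk G t u a))\<^sup>2) = 1"
proof -
  interpret pair_graph G by (rule G)
  have symE: "(x, y) \<in> parcs G \<longleftrightarrow> (y, x) \<in> parcs G" for x y
    using pair_sym_arcs by (auto simp: symmetric_def dest: symD)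
  show ?thesis
    unfolding laplacian_walk_def
    by (rule mat_exp_antihermitian_column) (use assms symE in \<open>auto simp: laplacian_def\<close>)
qed

text \<open>
  As the columns of the walk are unit vectors, \<open>|U b a| \<rightarrow> 1\<close> forces the other entries of column \<open>a\<close>
  to vanish.  Pairing the column with \<open>v\<close> gives \<open>exp (- \<i> \<tau> \<theta>) v a - U b a v b \<rightarrow> 0\<close>, and the constant
  eigenvector shows that \<open>U b a \<rightarrow> 1\<close>.
\<close>

lemma laplacian_pgst_eigenvector_limit:
  assumes G: "pair_graph G" and a: "a \<in> pverts G" and b: "b \<in> pverts G"
    and pgst: "laplacian_pgst G a b"
  obtains \<tau> :: "nat \<Rightarrow> real" where
    "\<And>\<theta> v. laplacian_eigenvector G \<theta> v \<Longrightarrow>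
       (\<lambda>s. exp (- \<i> * \<tau> s * \<theta>) * v a) \<longlonglongrightarrow> complex_of_real (v b)"
proof -
  interpret pair_graph G by (rule G)
  have "\<exists>t. cmod (laplacian_walk G t b a) > 1 - 1 / real (Suc s)" for s
    using pgst by (simp add: laplacian_pgst_def)
  then obtain \<tau> where \<tau>: "\<And>s. cmod (laplacian_walk G (\<tau> s) b a) > 1 - 1 / real (Suc s)"
    by metis
  define U where "U s u = laplacian_walk G (\<tau> s) u a" for s u
  have unit: "(\<Sum>u\<in>pverts G. (cmod (U s u))\<^sup>2) = 1" for s
    unfolding U_def using laplacian_walk_column[OF G a] .
  have le1: "cmod (U s b) \<le> 1" for s
  proof -
    have "(cmod (U s b))\<^sup>2 \<le> (\<Sum>u\<in>pverts G. (cmod (U s u))\<^sup>2)"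
      by (rule member_le_sum) (use b in auto)
    then show ?thesis using unit by (simp add: abs_square_le_1)
  qed
  have lim1: "(\<lambda>s. cmod (U s b)) \<longlonglongrightarrow> 1"
  proof (rule tendsto_sandwich)
    show "(\<lambda>s. 1 - 1 / real (Suc s)) \<longlonglongrightarrow> 1"
      using tendsto_diff[OF tendsto_const[of 1] lim_1_over_n[THEN LIMSEQ_Suc]] by simp
    show "\<forall>\<^sub>F s in sequentially. 1 - 1 / real (Suc s) \<le> cmod (U s b)"
      using \<tau> by (simp add: U_def less_imp_le)
    show "\<forall>\<^sub>F s in sequentially. cmod (U s b) \<le> 1" using le1 by simp
  qed simp
  have lim0: "(\<lambda>s. U s u) \<longlonglongrightarrow> 0" if "u \<in> pverts G" "u \<noteq> b" for u
  proof -
    have le: "norm ((cmod (U s u))\<^sup>2) \<le> 1 - (cmod (U s b))\<^sup>2" for s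
    proof -
      have "(cmod (U s u))\<^sup>2 \<le> (\<Sum>u\<in>pverts G - {b}. (cmod (U s u))\<^sup>2)"
        by (rule member_le_sum) (use that in auto)
      then show ?thesis using unit[of s] b by (simp add: sum_diff1)
    qed
    have "(\<lambda>s. 1 - (cmod (U s b))\<^sup>2) \<longlonglongrightarrow> 0"
      using tendsto_diff[OF tendsto_const[of 1] tendsto_power[OF lim1, of 2]] by simp
    then have "(\<lambda>s. (cmod (U s u))\<^sup>2) \<longlonglongrightarrow> 0"
      by (rule Lim_null_comparison[rotated]) (use le in simp)
    from tendsto_real_sqrt[OF this] show ?thesis
      by (simp add: tendsto_norm_zero_iff)
  qed
  have diff: "(\<lambda>s. exp (- \<i> * \<tau> s * \<theta>) * v a - v b * U s b) \<longlonglongrightarrow> 0"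
    if "laplacian_eigenvector G \<theta> v" for \<theta> v
  proof -
    have "exp (- \<i> * \<tau> s * \<theta>) * v a - v b * U s b = (\<Sum>u\<in>pverts G - {b}. v u * U s u)" for s
      using laplacian_walk_eigenvector[OF G a that, of "\<tau> s"] b by (simp add: U_def sum_diff1)
    moreover have "(\<lambda>s. \<Sum>u\<in>pverts G - {b}. v u * U s u) \<longlonglongrightarrow> 0"
      by (intro tendsto_null_sum tendsto_mult_right_zero lim0) auto
    ultimately show ?thesis by simp
  qed
  have "laplacian_eigenvector G 0 (\<lambda>_. 1)"
    by (simp add: laplacian_eigenvector_def)
  from tendsto_diff[OF tendsto_const[of 1] diff[OF this]]
  have one: "(\<lambda>s. U s b) \<longlonglongrightarrow> 1" by simp
  show thesis
  proof (rule that)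
    fix \<theta> v assume "laplacian_eigenvector G \<theta> v"
    from tendsto_add[OF diff[OF this] tendsto_mult[OF tendsto_const[of "of_real (v b)"] one]]
    show "(\<lambda>s. exp (- \<i> * \<tau> s * \<theta>) * v a) \<longlonglongrightarrow> complex_of_real (v b)" by simp
  qed
qed

section \<open>Eigenvectors of cartesian products and paths\<close>

text \<open>A move in any other coordinate leaves \<open>f (x i)\<close> unchanged and contributes
  \<open>0\<close>; the moves in coordinate \<open>i\<close> reproduce the neighbour sum of the
  factor.\<close>

lemma laplacian_eigenvector_cart_prod:
  assumes G: "\<And>i. i \<in> I \<Longrightarrow> pair_graph (G i)" and "finite I" and i: "i \<in> I"
    and eig: "laplacian_eigenvector (G i) \<theta> f"
  shows "laplacian_eigenvector (cart_prod I G) \<theta> (\<lambda>x. f (x i))"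
  unfolding laplacian_eigenvector_def
proof
  interpret P: pair_graph "cart_prod I G" using pair_graph_cart_prod[OF \<open>finite I\<close> G] .
  interpret Gi: pair_graph "G i" by (rule G[OF i])
  fix y assume y: "y \<in> pverts (cart_prod I G)"
  let ?N = "{c. (y i, c) \<in> parcs (G i)}" and ?M = "{x. (y, x) \<in> parcs (cart_prod I G)}"
  have yi: "y i \<in> pverts (G i)" using y i by (auto simp: cart_prod_def)
  have finM: "finite ?M" using P.in_arcsD2 by (auto intro!: finite_subset[OF _ P.pair_finite_verts])
  have sub: "(\<lambda>c. y(i := c)) ` ?N \<subseteq> ?M"
    using y i Gi.in_arcsD2 by (auto simp: cart_prod_def PiE_iff extensional_def)
  have "f (y i) - f (x i) = 0" if x: "x \<in> ?M - (\<lambda>c. y(i := c)) ` ?N" for x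
  proof (rule ccontr)
    assume ne: "f (y i) - f (x i) \<noteq> 0"
    have ext: "x \<in> extensional I" "y \<in> extensional I"
      using x by (simp_all add: cart_prod_def PiE_iff)
    obtain l where l: "(y l, x l) \<in> parcs (G l)" "\<And>j. j \<in> I \<Longrightarrow> j \<noteq> l \<Longrightarrow> y j = x j"
      using x by (auto simp: cart_prod_def)
    have "l = i" using l(2)[OF i] ne by force
    have "x j = (y(i := x i)) j" for j
    proof (cases "j \<in> I")
      case True
      then show ?thesis using l(2)[of j] \<open>l = i\<close> by simp
    next
      case False
      then show ?thesis using ext i by (auto simp: extensional_def)
    qed
    then have "x = y(i := x i)" ..
    then show False using x l(1) \<open>l = i\<close> by blast
  qed
  then have "(\<Sum>x\<in>?M. f (y i) - f (x i)) = (\<Sum>x\<in>(\<lambda>c. y(i := c)) ` ?N. f (y i) - f (x i))"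
    by (intro sum.mono_neutral_right finM sub) auto
  also have "\<dots> = (\<Sum>c\<in>?N. f (y i) - f c)"
    by (subst sum.reindex) (auto simp: inj_on_def dest: fun_upd_eqD)
  also have "\<dots> = \<theta> * f (y i)" using eig yi by (simp add: laplacian_eigenvector_def)
  finally show "(\<Sum>x\<in>?M. f (y i) - f (x i)) = \<theta> * f (y i)" .
qed

definition path_eigenvalue :: "nat \<Rightarrow> nat \<Rightarrow> real" where
  "path_eigenvalue n j = 2 - 2 * cos (pi * real j / real n)"

text \<open>The sampled cosine satisfies a three-term recurrence on the whole line and is symmetric
  about \<open>1 / 2\<close> and \<open>n + 1 / 2\<close>, so the recurrence survives at both ends
  of the path.\<close>

lemma laplacian_eigenvector_path_graph:
  assumes "n \<ge> 1"
  shows "laplacian_eigenvector (path_graph n) (path_eigenvalue n j)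
           (\<lambda>a. cos (pi * real j * (2 * real a - 1) / (2 * real n)))"
  unfolding laplacian_eigenvector_def
proof
  define \<phi> where "\<phi> = pi * j / n"
  define f where "f x = cos (\<phi> * (x - 1 / 2))" for x
  have f: "cos (pi * real j * (2 * real a - 1) / (2 * real n)) = f (real a)" for a
    unfolding f_def \<phi>_def using assms by (intro arg_cong[where f = cos]) (simp add: field_simps)
  fix a assume "a \<in> pverts (path_graph n)"
  then have a: "1 \<le> a" "a \<le> n" by (auto simp: path_graph_def)
  have rec: "(f x - f (x - 1)) + (f x - f (x + 1)) = path_eigenvalue n j * f x" for x
  proof -
    define y where "y = \<phi> * (x - 1 / 2)"
    have "f x = cos y" "f (x - 1) = cos (y - \<phi>)" "f (x + 1) = cos (y + \<phi>)"
      unfolding f_def y_def by (intro arg_cong[where f = cos]; simp add: algebra_simps)+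
    then show ?thesis
      by (simp add: path_eigenvalue_def cos_add cos_diff algebra_simps flip: \<phi>_def)
  qed
  have left: "f 1 = f 0" by (simp add: f_def)
  have right: "f (real n + 1) = f n"
  proof -
    have "\<phi> * n = pi * j" using assms by (simp add: \<phi>_def)
    then have "f (real n + 1) = cos (pi * j + \<phi> / 2)" "f n = cos (pi * j - \<phi> / 2)"
      unfolding f_def by (simp_all add: algebra_simps)
    then show ?thesis by (simp add: cos_add cos_diff mult.commute[of pi])
  qed
  have "{u. (a, u) \<in> parcs (path_graph n)}
      = (if a > 1 then {a - 1} else {}) \<union> (if a < n then {a + 1} else {})"
    using a by (auto simp: path_graph_def)
  then have "(\<Sum>u | (a, u) \<in> parcs (path_graph n). f a - f u)
      = (if a > 1 then f a - f (a - 1) else 0) + (if a < n then f a - f (a + 1) else 0)"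
    by (auto simp: sum.union_disjoint)
  \<comment> \<open>A missing neighbour is supplied by position \<open>0\<close> or
    \<open>n + 1\<close>, where \<open>left\<close> and \<open>right\<close> make the difference
    vanish.\<close>
  also have "\<dots> = (f a - f (real a - 1)) + (f a - f (real a + 1))"
    using a left right by (auto simp: add.commute le_less)
  finally show "(\<Sum>u | (a, u) \<in> parcs (path_graph n).
        cos (pi * real j * (2 * real a - 1) / (2 * real n)) - cos (pi * real j * (2 * real u - 1) / (2 * real n)))
      = path_eigenvalue n j * cos (pi * real j * (2 * real a - 1) / (2 * real n))"
    unfolding f rec .
qed

section \<open>Cosine relations and powers of two\<close>

text \<open>This is the real part of the vanishing geometric sum over the \<open>p\<close>-th roots
  of unity, rotated by \<alpha>.\<close>

lemma sum_cos_equidistributed: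
  assumes "p > 1"
  shows "(\<Sum>k<p. cos (\<alpha> + 2 * pi * real k / real p)) = 0"
proof -
  let ?\<omega> = "cis (2 * pi / p)"
  have "?\<omega> \<noteq> 1"
  proof
    assume "?\<omega> = 1"
    from arg_cong[OF this, of Re] have "cos (2 * pi / p) = 1" by simp
    \<comment> \<open>As \<open>p\<close> is at least 2, the angle lies in the interval from 0 to
      \<open>pi\<close>, on which cosine strictly decreases.\<close>
    moreover have "cos (2 * pi / p) < cos 0"
      using assms by (intro cos_monotone_0_pi) (simp_all add: pos_divide_le_eq)
    ultimately show False by simp
  qed
  moreover have "?\<omega> ^ p = 1" using assms by (simp add: Complex.DeMoivre)
  ultimately have "(\<Sum>k<p. ?\<omega> ^ k) = 0" by (simp add: sum_gp_strict)
  then have "0 = Re (cis \<alpha> * (\<Sum>k<p. ?\<omega> ^ k))" by simp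
  also have "\<dots> = (\<Sum>k<p. cos (\<alpha> + 2 * pi * real k / real p))"
    unfolding sum_distrib_left Re_sum
    by (intro sum.cong refl) (simp add: Complex.DeMoivre cis_mult mult_ac)
  finally show ?thesis by simp
qed

lemma power_of_2_or_odd_dvd:
  fixes n :: nat
  assumes "n > 0"
  shows "(\<exists>r. n = 2 ^ r) \<or> (\<exists>p>1. odd p \<and> p dvd n)"
  using assms
proof (induction n rule: less_induct)
  case (less n)
  show ?case
  proof (cases "even n")
    case True
    then obtain m where m: "n = 2 * m" by blast
    have "(\<exists>r. m = 2 ^ r) \<or> (\<exists>p>1. odd p \<and> p dvd m)"
      by (intro less.IH) (use less.prems m in auto)
    then show ?thesis
    proof (elim disjE exE conjE)
      fix r assume "m = 2 ^ r"
      then have "n = 2 ^ Suc r" using m by simp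
      then show ?thesis by blast
    next
      fix p assume "p > 1" "odd p" "p dvd m"
      then show ?thesis using m by (metis dvd_mult)
    qed
  next
    case False
    show ?thesis
    proof (cases "n = 1")
      case True
      then have "n = 2 ^ 0" by simp
      then show ?thesis by blast
    next
      case False
      then have "n > 1" using less.prems by simp
      then show ?thesis using \<open>odd n\<close> dvd_refl by blast
    qed
  qed
qed

text \<open>
  Since \<open>\<theta>\<^sub>n = 4 = \<theta>\<^sub>1 + \<theta>\<^bsub>n-1\<^esub>\<close> and \<open>\<theta>\<^bsub>2n-j\<^esub> = \<theta>\<^sub>j\<close>, the alternating phases extend to all \<open>j < 2 n\<close>.  If
  \<open>n = p m\<close> with \<open>p > 1\<close> odd, then \<open>\<theta>\<^bsub>c+2mk\<^esub>\<close> summed over \<open>k < p\<close> is \<open>2 p\<close> for every \<open>c\<close>, so the phase of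
  \<open>2 p\<close> tends to \<open>(- 1) ^ c\<close> for both \<open>c = 0\<close> and \<open>c = 1\<close>.
\<close>

lemma alternating_path_phases_imp_power_of_2:
  fixes \<tau> :: "nat \<Rightarrow> real"
  assumes "n \<ge> 2"
    and lim: "\<And>j. j < n \<Longrightarrow> (\<lambda>s. exp (- \<i> * \<tau> s * path_eigenvalue n j)) \<longlonglongrightarrow> (- 1) ^ j"
  shows "\<exists>r. n = 2 ^ r"
proof (rule ccontr)
  assume "\<nexists>r. n = 2 ^ r"
  then obtain p where p: "p > 1" "odd p" "p dvd n"
    using power_of_2_or_odd_dvd[of n] \<open>n \<ge> 2\<close> by auto
  then obtain m where n: "n = p * m" by auto
  then have "m > 0" using \<open>n \<ge> 2\<close> by (cases m) auto
  let ?E = "\<lambda>\<theta>::real. (\<lambda>s. exp (- \<i> * \<tau> s * \<theta>))"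
  have lim_n: "?E (path_eigenvalue n n) \<longlonglongrightarrow> (- 1) ^ n"
  proof -
    have "pi * real (n - 1) / real n = pi - pi / n"
      using \<open>n \<ge> 2\<close> by (simp add: field_simps)
    then have "path_eigenvalue n n = path_eigenvalue n 1 + path_eigenvalue n (n - 1)"
      using \<open>n \<ge> 2\<close> by (simp add: path_eigenvalue_def cos_diff)
    then have "?E (path_eigenvalue n n)
        = (\<lambda>s. ?E (path_eigenvalue n 1) s * ?E (path_eigenvalue n (n - 1)) s)"
      by (simp add: algebra_simps flip: exp_add)
    moreover have "(- 1) ^ 1 * (- 1) ^ (n - 1) = ((- 1) ^ n :: complex)"
      using \<open>n \<ge> 2\<close> by (cases n) auto
    ultimately show ?thesis
      using tendsto_mult[OF lim[of 1] lim[of "n - 1"]] \<open>n \<ge> 2\<close> by simp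
  qed
  have lim2: "?E (path_eigenvalue n j) \<longlonglongrightarrow> (- 1) ^ j" if "j < 2 * n" for j
  proof (cases j n rule: linorder_cases)
    case greater
    have "pi * real (2 * n - j) / n = 2 * pi - pi * j / n"
      using that by (simp add: field_simps)
    then have "path_eigenvalue n (2 * n - j) = path_eigenvalue n j"
      by (simp add: path_eigenvalue_def cos_diff)
    moreover have "(- 1) ^ (2 * n - j) = ((- 1) ^ j :: complex)"
      using that by (simp add: minus_one_power_iff)
    ultimately show ?thesis using lim[of "2 * n - j"] greater that by simp
  qed (use lim lim_n in auto)
  have sum: "(\<Sum>k<p. path_eigenvalue n (c + 2 * m * k)) = 2 * p" for c
  proof -
    have "cos (pi * real (c + 2 * m * k) / n) = cos (pi * c / n + 2 * pi * real k / real p)" for k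
      using \<open>m > 0\<close> p(1) n by (intro arg_cong[where f = cos]) (simp add: field_simps)
    then show ?thesis
      using sum_cos_equidistributed[OF p(1), of "pi * c / n"]
      by (simp add: path_eigenvalue_def sum_subtractf flip: sum_distrib_left)
  qed
  have prod: "?E (2 * p) \<longlonglongrightarrow> (- 1) ^ c" if "c < 2" for c
  proof -
    have "c + 2 * m * k < 2 * n" if "k < p" for k
    proof -
      have "m * (k + 1) \<le> m * p" using that by (intro mult_le_mono) auto
      then show ?thesis using \<open>m > 0\<close> \<open>c < 2\<close> n by (simp add: algebra_simps)
    qed
    then have "(\<lambda>s. \<Prod>k<p. ?E (path_eigenvalue n (c + 2 * m * k)) s)
        \<longlonglongrightarrow> (\<Prod>k<p. (- 1) ^ (c + 2 * m * k))"
      by (intro tendsto_prod lim2) auto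
    moreover have "(\<Prod>k<p. ?E (path_eigenvalue n (c + 2 * m * k)) s) = ?E (2 * p) s" for s
      unfolding sum[of c, symmetric] by (simp add: sum_distrib_left exp_sum)
    \<comment> \<open>All exponents have the parity of \<open>c\<close>, and an odd number of equal
      signs multiplies to that sign.\<close>
    moreover have "(\<Prod>k<p. (- 1) ^ (c + 2 * m * k)) = ((- 1) ^ c :: complex)"
      using p(2) that by (auto simp: minus_one_power_iff)
    ultimately show ?thesis by simp
  qed
  show False
    using LIMSEQ_unique[OF prod[of 0] prod[of 1]] by simp
qed

section \<open>Phases between corners of the grid\<close>

text \<open>Dividing each eigenvector limit by the entry at the starting corner isolates the phase:
  the ratio is a sign in coordinate \<open>i\<close> and \<open>1\<close> in every coordinate that
  stays fixed.\<close>

lemma grid_pgst_phases: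
  assumes n: "\<And>i. i \<in> {1..k} \<Longrightarrow> n i \<ge> 2" and i: "i \<in> {1..k}"
    and pgst: "\<forall>a \<in> grid_corners k n. \<forall>b \<in> grid_corners k n. laplacian_pgst (grid_graph k n) a b"
  obtains \<tau> :: "nat \<Rightarrow> real" where
    "\<And>j. j < n i \<Longrightarrow> (\<lambda>s. exp (- \<i> * \<tau> s * path_eigenvalue (n i) j)) \<longlonglongrightarrow> (- 1) ^ j"
    "\<And>l j. l \<in> {1..k} - {i} \<Longrightarrow> j < n l \<Longrightarrow>
       (\<lambda>s. exp (- \<i> * \<tau> s * path_eigenvalue (n l) j)) \<longlonglongrightarrow> 1"
proof -
  define a where "a = (\<lambda>l\<in>{1..k}. 1::nat)"
  define b where "b = a(i := n i)"
  have n1: "\<And>l. 1 \<le> l \<Longrightarrow> l \<le> k \<Longrightarrow> Suc 0 \<le> n l" using n by force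
  have "a \<in> grid_corners k n" "b \<in> grid_corners k n"
    using n1 i
    by (auto simp: grid_corners_def grid_graph_def cart_prod_def path_graph_def a_def b_def PiE_iff
        extensional_def)
  moreover from this have "a \<in> pverts (grid_graph k n)" "b \<in> pverts (grid_graph k n)"
    by (auto simp: grid_corners_def)
  ultimately obtain \<tau> :: "nat \<Rightarrow> real" where \<tau>: "\<And>\<theta> v. laplacian_eigenvector (grid_graph k n) \<theta> v \<Longrightarrow>
       (\<lambda>s. exp (- \<i> * \<tau> s * \<theta>) * v a) \<longlonglongrightarrow> complex_of_real (v b)"
    using laplacian_pgst_eigenvector_limit[OF pair_graph_grid_graph, of a k n b] pgst by metis
  define f where "f l j x = cos (pi * real j * (2 * real x - 1) / (2 * real (n l)))" for l j x
  have lim: "(\<lambda>s. exp (- \<i> * \<tau> s * path_eigenvalue (n l) j) * f l j 1) \<longlonglongrightarrow> f l j (b l)"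
    if "l \<in> {1..k}" for l j
  proof -
    have "laplacian_eigenvector (grid_graph k n) (path_eigenvalue (n l) j) (\<lambda>x. f l j (x l))"
      unfolding grid_graph_def f_def
      using n1 that
      by (intro laplacian_eigenvector_cart_prod pair_graph_path_graph
          laplacian_eigenvector_path_graph) auto
    from \<tau>[OF this] show ?thesis using that by (simp add: a_def)
  qed
  \<comment> \<open>The bound on \<open>j\<close> keeps the angle below \<open>pi / 2\<close>; at
    \<open>j = n l\<close> the entry would be \<open>0\<close>.\<close>
  have pos: "f l j 1 \<noteq> 0" if "l \<in> {1..k}" "j < n l" for l j
  proof -
    have "cos (pi * real j / (2 * real (n l))) > 0"
      using that by (intro cos_gt_zero_pi) (auto simp: field_simps intro: order_less_le_trans[of _ 0])
    then show ?thesis by (simp add: f_def)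
  qed
  have quot: "(\<lambda>s. exp (- \<i> * \<tau> s * path_eigenvalue (n l) j)) \<longlonglongrightarrow> complex_of_real (f l j (b l) / f l j 1)"
    if "l \<in> {1..k}" "j < n l" for l j
    using tendsto_divide[OF lim[OF that(1)] tendsto_const, of "of_real (f l j 1)" j] pos[OF that]
    by simp
  show thesis
  proof (rule that[of \<tau>])
    fix j assume j: "j < n i"
    \<comment> \<open>The angle at the far end is \<open>pi * j\<close> minus the angle at vertex
      \<open>1\<close>, which yields the alternating sign.\<close>
    have "pi * real j * (2 * real (n i) - 1) / (2 * real (n i)) = pi * j - pi * j / (2 * n i)"
      using j by (simp add: field_simps)
    then have "f i j (n i) = (- 1) ^ j * f i j 1"
      by (simp add: f_def cos_diff)
    then show "(\<lambda>s. exp (- \<i> * \<tau> s * path_eigenvalue (n i) j)) \<longlonglongrightarrow> (- 1) ^ j"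
      using quot[OF i j] pos[OF i j] by (simp add: b_def)
  next
    fix l j assume l: "l \<in> {1..k} - {i}" and j: "j < n l"
    then have "b l = 1" by (auto simp: b_def a_def)
    then show "(\<lambda>s. exp (- \<i> * \<tau> s * path_eigenvalue (n l) j)) \<longlonglongrightarrow> 1"
      using quot[of l j] pos[of l j] l j by simp
  qed
qed

theorem theorem6p2:
  fixes k :: nat and n :: "nat \<Rightarrow> nat"
  assumes "k \<ge> 2"
    and "\<And>i. i \<in> {1..k} \<Longrightarrow> n i \<ge> 2"
  shows "\<not> (\<forall>a \<in> grid_corners k n. \<forall>b \<in> grid_corners k n. laplacian_pgst (grid_graph k n) a b)"
proof
  assume pgst: "\<forall>a \<in> grid_corners k n. \<forall>b \<in> grid_corners k n. laplacian_pgst (grid_graph k n) a b"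
  note phases = grid_pgst_phases[OF assms(2) _ pgst]
  have pow: "\<exists>r. n i = 2 ^ r" if i: "i \<in> {1..k}" for i
    using phases[OF _ i] alternating_path_phases_imp_power_of_2[OF assms(2)[OF i]] by metis
  \<comment> \<open>The two corners will differ in the coordinate of the shorter path, so that
    \<open>n i\<close> divides \<open>n l\<close>.\<close>
  obtain i l where il: "i \<in> {1..k}" "l \<in> {1..k} - {i}" "n i \<le> n l"
  proof (cases "n 1 \<le> n 2")
    case True
    then show ?thesis using that[of 1 2] assms(1) by auto
  next
    case False
    then show ?thesis using that[of 2 1] assms(1) by auto
  qed
  obtain r s where rs: "n i = 2 ^ r" "n l = 2 ^ s"
    using pow[of i] pow[of l] il(1,2) by auto
  then have "r \<le> s" using il(3) by simp
  then obtain q where q: "n l = n i * q"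
    using rs by (metis dvdE le_imp_power_dvd)
  have n2: "n i \<ge> 2" "n l \<ge> 2" using assms(2) il by auto
  obtain \<tau> where \<tau>:
    "\<And>j. j < n i \<Longrightarrow> (\<lambda>s. exp (- \<i> * complex_of_real (\<tau> s) * path_eigenvalue (n i) j)) \<longlonglongrightarrow> (- 1) ^ j"
    "\<And>l j. l \<in> {1..k} - {i} \<Longrightarrow> j < n l \<Longrightarrow>
       (\<lambda>s. exp (- \<i> * complex_of_real (\<tau> s) * path_eigenvalue (n l) j)) \<longlonglongrightarrow> 1"
    using phases[OF _ il(1)] by metis
  have "q > 0" using q n2 by (cases q) auto
  then have "q < n l" using q n2 by simp
  \<comment> \<open>Since \<open>n l = n i * q\<close>, both angles equal \<open>pi / n i\<close>;
    this shared eigenvalue gets the contradictory limits \<open>1\<close> and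
    \<open>- 1\<close>.\<close>
  moreover have "path_eigenvalue (n l) q = path_eigenvalue (n i) 1"
    using q \<open>q > 0\<close> by (simp add: path_eigenvalue_def)
  ultimately have "(\<lambda>s. exp (- \<i> * complex_of_real (\<tau> s) * path_eigenvalue (n i) 1)) \<longlonglongrightarrow> 1"
    using \<tau>(2)[OF il(2), of q] by simp
  from LIMSEQ_unique[OF this \<tau>(1)[of 1]] n2 show False by simp
qed

end
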